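(* Let $H$ be a fixed graph and let $r=\min\{\Delta^+(D): D \text{ is an orientation of } H\}$, where $\Delta^+(D)$ denotes the maximum out-degree of $D$. Let $f,g:\mathbb{N}\to\mathbb{R}$ be functions such that $f(n)\to 0$ (arbitrarily slowly) and $g(n)\to\infty$ (arbitrarily slowly) as $n\to\infty$. Then w.h.p. $f(n)\cdot n^{(r-1)/r}\le \tau'(\mathcal{P}_H,n)\le g(n)\cdot n^{(r-1)/r}$.
   Context: Semi-random multigraph process: fix $n$ and start with the empty multigraph on vertex set $[n]=\{1,\dots,n\}$. In each round $t=1,2,\dots$, a vertex $v_t$ is chosen uniformly at random from $[n]$, independently of all previous rounds; Builder then chooses a vertex $u_t\in[n]$ (possibly $u_t=v_t$) and adds the edge $u_tv_t$ to his multigraph (loops and multiple edges allowed). In the offline version, Builder is given the entire sequence $(v_t)_{t\ge1}$ before the game starts, so his (possibly randomized) strategy may choose $u_t$ depending on the whole sequence. For a strategy $\mathcal S$ let $G_m$ be Builder's multigraph after $m$ rounds. For a monotone increasing graph property $\mathcal P$ and $0\le p\le 1$, $\tau'_p(\mathcal S)$ is the least $m$ with $\Pr(G_m\in\mathcal P)\ge p$ ($+\infty$ if none) and $\tau'_p(\mathcal P,n)=\min_{\mathcal S}\tau'_p(\mathcal S)$. "W.h.p. $\tau'(\mathcal P,n)\le m(n)$" means $\tau'_{1-\varepsilon(n)}(\mathcal P,n)\le m(n)$ for some $\varepsilon(n)\to0$ (some strategy achieves $\mathcal P$ within $m(n)$ rounds with probability $1-o(1)$); "w.h.p. $\tau'(\mathcal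 P,n)\ge m(n)$" means $\tau'_{\varepsilon(n)}(\mathcal P,n)\ge m(n)$ for some $\varepsilon(n)\to 0$ (for every strategy, w.h.p. the multigraph after fewer than $m(n)$ rounds does not satisfy $\mathcal P$). $\mathcal P_H$ is the property of containing $H$ as a subgraph. *)

theory Defs
  imports "HOL-Probability.Probability"
begin

definition simple_graph :: "'a set \<Rightarrow> 'a set set \<Rightarrow> bool" where
  "simple_graph V E \<longleftrightarrow> finite V \<and> (\<forall>e\<in>E. e \<subseteq> V \<and> card e = 2)"

definition orientation :: "'a set set \<Rightarrow> ('a \<times> 'a) set \<Rightarrow> bool" where
  "orientation E D \<longleftrightarrow>
     (\<forall>x y. (x, y) \<in> D \<longrightarrow> {x, y} \<in> E) \<and>
     (\<forall>x y. {x, y} \<in> E \<longrightarrow> ((x, y) \<in> D) \<noteq> ((y, x) \<in> D))"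

definition max_out_degree :: "'a set \<Rightarrow> ('a \<times> 'a) set \<Rightarrow> nat" where
  "max_out_degree V D = Max ((\<lambda>x. card (D `` {x})) ` V)"

definition min_max_out_degree :: "'a set \<Rightarrow> 'a set set \<Rightarrow> nat" where
  "min_max_out_degree V E = Min (max_out_degree V ` {D. orientation E D})"

text \<open>
  A multigraph is a vertex set with a multiset of edges. The edge joining \<open>a\<close> and \<open>b\<close> is
  the set \<open>{a, b}\<close>; thus loops are singletons.
\<close>

type_synonym multigraph = "nat set \<times> nat set multiset"

text \<open>Since the pattern graph is simple, edge multiplicities of the host are irrelevant.\<close>

definition contains_copy :: "'a set \<Rightarrow> 'a set set \<Rightarrow> multigraph \<Rightarrow> bool" where
  "contains_copy V E G \<longleftrightarrow>
     (\<exists>\<phi>. inj_on \<phi> V \<and> \<phi> ` V \<subseteq> fst G \<and> (\<forall>e\<in>E. \<phi> ` e \<in># snd G))"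

text \<open>
  Sequences are indexed from 0: the vertices of round \<open>t + 1\<close> are \<open>v t\<close> and \<open>u t\<close>.
\<close>

definition vertex_seqs :: "nat \<Rightarrow> (nat \<Rightarrow> nat) measure" where
  "vertex_seqs n = PiM UNIV (\<lambda>_. count_space {1..n})"

definition random_seq :: "nat \<Rightarrow> (nat \<Rightarrow> nat) measure" where
  "random_seq n = PiM UNIV (\<lambda>_. uniform_count_measure {1..n})"

text \<open>
  A randomized offline strategy is a probability kernel: it maps the whole sequence of offered
  vertices to a distribution on the sequences of Builder's replies. Deterministic strategies are
  the kernels all of whose values are Dirac measures.
\<close>

definition strategies :: "nat \<Rightarrow> ((nat \<Rightarrow> nat) \<Rightarrow> (nat \<Rightarrow> nat) measure) set" where
  "strategies n = vertex_seqs n \<rightarrow>\<^sub>M prob_algebra (vertex_seqs n)"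

definition process_law ::
  "nat \<Rightarrow> ((nat \<Rightarrow> nat) \<Rightarrow> (nat \<Rightarrow> nat) measure) \<Rightarrow> ((nat \<Rightarrow> nat) \<times> (nat \<Rightarrow> nat)) measure" where
  "process_law n S =
     random_seq n \<bind> (\<lambda>v. S v \<bind> (\<lambda>u. return (vertex_seqs n \<Otimes>\<^sub>M vertex_seqs n) (v, u)))"

definition builder_graph :: "nat \<Rightarrow> nat \<Rightarrow> (nat \<Rightarrow> nat) \<Rightarrow> (nat \<Rightarrow> nat) \<Rightarrow> multigraph" where
  "builder_graph n m v u = ({1..n}, image_mset (\<lambda>t. {u t, v t}) (mset_set {..<m}))"

definition success_prob ::
  "(multigraph \<Rightarrow> bool) \<Rightarrow> nat \<Rightarrow> ((nat \<Rightarrow> nat) \<Rightarrow> (nat \<Rightarrow> nat) measure) \<Rightarrow> nat \<Rightarrow> real" where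
  "success_prob P n S m =
     measure (process_law n S)
       {(v, u) \<in> space (process_law n S). P (builder_graph n m v u)}"

text \<open>
  In \<^typ>\<open>enat\<close> the infimum of the empty set is \<open>\<infinity>\<close> and that of a nonempty set is its minimum.
\<close>

definition tau_strategy ::
  "(multigraph \<Rightarrow> bool) \<Rightarrow> nat \<Rightarrow> real \<Rightarrow> ((nat \<Rightarrow> nat) \<Rightarrow> (nat \<Rightarrow> nat) measure) \<Rightarrow> enat" where
  "tau_strategy P n p S = (INF m \<in> {m. success_prob P n S m \<ge> p}. enat m)"

definition tau :: "(multigraph \<Rightarrow> bool) \<Rightarrow> nat \<Rightarrow> real \<Rightarrow> enat" where
  "tau P n p = (INF S \<in> strategies n. tau_strategy P n p S)"

definition whp_tau_le :: "(multigraph \<Rightarrow> bool) \<Rightarrow> (nat \<Rightarrow> real) \<Rightarrow> bool" where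
  "whp_tau_le P m \<longleftrightarrow>
     (\<exists>\<epsilon>. (\<forall>n. 0 \<le> \<epsilon> n \<and> \<epsilon> n \<le> 1) \<and> \<epsilon> \<longlonglongrightarrow> 0 \<and>
        (\<forall>\<^sub>F n in sequentially. ereal_of_enat (tau P n (1 - \<epsilon> n)) \<le> ereal (m n)))"

definition whp_tau_ge :: "(multigraph \<Rightarrow> bool) \<Rightarrow> (nat \<Rightarrow> real) \<Rightarrow> bool" where
  "whp_tau_ge P m \<longleftrightarrow>
     (\<exists>\<epsilon>. (\<forall>n. 0 \<le> \<epsilon> n \<and> \<epsilon> n \<le> 1) \<and> \<epsilon> \<longlonglongrightarrow> 0 \<and>
        (\<forall>\<^sub>F n in sequentially. ereal (m n) \<le> ereal_of_enat (tau P n (\<epsilon> n))))"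

end

theory Submission imports Defs "HOL-Real_Asymp.Real_Asymp" begin

text \<open>
  If the graph after \<open>m\<close> rounds contains \<open>H\<close>, orienting each edge of the copy away from the vertex
  offered in its round shows that some vertex was offered at least \<open>r\<close> times; by a union bound this
  has probability at most \<open>n (m / n)^r\<close>, which is \<open>f(n)^r\<close> at \<open>m = f(n) n^((r - 1) / r)\<close>.

  Conversely, fix an orientation of \<open>H\<close> with out-degrees at most \<open>r\<close>. If \<open>|V(H)|\<close> vertices are each
  offered \<open>r\<close> times, then Builder can embed \<open>V(H)\<close> there and draw every edge in a round in which its
  tail is offered. To get such vertices, reserve for each vertex of \<open>H\<close> its own part \<open>A\<close> of \<open>[n]\<close>, of
  linear size, and its own \<open>r\<close> disjoint intervals of \<open>L\<close> rounds. The number of ways to choose a vertex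
  of \<open>A\<close> together with one occurrence in each interval has mean \<open>\<mu> = |A| (L / n)^r\<close> and
  variance at most \<open>2^r \<mu>\<close>, so by Chebyshev's inequality it vanishes with probability at most \<open>2^r / \<mu>\<close>.
\<close>

section \<open>Uniformly random vertex sequences\<close>

lemma sets_random_seq [measurable_cong]: "sets (random_seq n) = sets (vertex_seqs n)"
  unfolding random_seq_def vertex_seqs_def
  by (intro sets_PiM_cong) (auto simp: sets_uniform_count_measure)

lemma space_vertex_seqs: "space (vertex_seqs n) = {v. \<forall>t. v t \<in> {1..n}}"
  by (auto simp: vertex_seqs_def space_PiM)

lemma space_random_seq: "space (random_seq n) = {v. \<forall>t. v t \<in> {1..n}}"
  using sets_eq_imp_space_eq[OF sets_random_seq] by (simp add: space_vertex_seqs)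

lemma measurable_vertex_seqs [measurable]: "(\<lambda>v. v t) \<in> vertex_seqs n \<rightarrow>\<^sub>M count_space {1..n}"
  unfolding vertex_seqs_def by simp

lemma measurable_random_seq [measurable]: "(\<lambda>v. v t) \<in> random_seq n \<rightarrow>\<^sub>M count_space {1..n}"
  using measurable_vertex_seqs measurable_cong_sets[OF sets_random_seq refl] by blast

lemma product_prob_space_uniform:
  fixes n :: nat
  assumes "n > 0"
  shows "product_prob_space (\<lambda>_::nat. uniform_count_measure {1..n})"
proof -
  interpret prob_space "uniform_count_measure {1..n}"
    using assms by (intro prob_space_uniform_count_measure) auto
  show ?thesis by unfold_locales
qed

lemma prob_space_random_seq:
  assumes "n > 0" shows "prob_space (random_seq n)"
  unfolding random_seq_def
  using assms by (intro prob_space_PiM prob_space_uniform_count_measure) auto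

lemma prob_random_seq_cylinder:
  assumes "n > 0" "finite T" "\<And>t. t \<in> T \<Longrightarrow> c t \<in> {1..n}"
  shows "measure (random_seq n) {v \<in> space (random_seq n). \<forall>t\<in>T. v t = c t} = (1 / n) ^ card T"
proof -
  interpret product_prob_space "\<lambda>_::nat. uniform_count_measure {1..n}" UNIV
    using product_prob_space_uniform[OF \<open>n > 0\<close>] .
  have eq: "{v \<in> space (random_seq n). \<forall>t\<in>T. v t = c t} =
     prod_emb UNIV (\<lambda>_. uniform_count_measure {1..n}) T (Pi\<^sub>E T (\<lambda>t. {c t}))"
    by (auto simp: prod_emb_def space_random_seq space_PiM PiE_iff space_uniform_count_measure
        restrict_def extensional_def)
  have "measure (random_seq n) {v \<in> space (random_seq n). \<forall>t\<in>T. v t = c t} =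
     (\<Prod>t\<in>T. measure (uniform_count_measure {1..n}) {c t})"
    unfolding eq unfolding random_seq_def using assms
    by (intro measure_PiM_emb) (auto simp: sets_uniform_count_measure)
  also have "\<dots> = (\<Prod>t\<in>T. 1 / n)"
  proof (intro prod.cong refl)
    fix t assume "t \<in> T"
    then show "measure (uniform_count_measure {1..n}) {c t} = 1 / n"
      using assms(3)[of t] by (subst measure_uniform_count_measure) auto
  qed
  finally show ?thesis by simp
qed

text \<open>Independence is read off from the joint law: the coordinates together have law
  \<open>random_seq n\<close>, which is the product of their marginals.\<close>

lemma indep_vars_random_seq:
  assumes "n > 0"
  shows "prob_space.indep_vars (random_seq n) (\<lambda>_. uniform_count_measure {1..n}) (\<lambda>t v. v t) (UNIV :: nat set)"
proof -
  interpret product_prob_space "\<lambda>_::nat. uniform_count_measure {1..n}" UNIV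
    using product_prob_space_uniform[OF \<open>n > 0\<close>] .
  interpret R: prob_space "random_seq n" using prob_space_random_seq[OF assms] .
  show ?thesis
  proof (subst R.indep_vars_iff_distr_eq_PiM')
    show "R.random_variable (uniform_count_measure {1..n}) (\<lambda>v. v t)" for t :: nat
      unfolding random_seq_def by simp
    have "distr (random_seq n) (Pi\<^sub>M UNIV (\<lambda>_. uniform_count_measure {1..n})) (\<lambda>v. \<lambda>i\<in>UNIV. v i) = random_seq n"
      unfolding random_seq_def restrict_def by (simp add: distr_id2)
    moreover have "distr (random_seq n) (uniform_count_measure {1..n}) (\<lambda>v. v t) = uniform_count_measure {1..n}" for t
      unfolding random_seq_def by (rule PiM_component) simp
    ultimately show "distr (random_seq n) (Pi\<^sub>M UNIV (\<lambda>_. uniform_count_measure {1..n})) (\<lambda>v. \<lambda>i\<in>UNIV. v i) =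
      Pi\<^sub>M UNIV (\<lambda>t. distr (random_seq n) (uniform_count_measure {1..n}) (\<lambda>v. v t))"
      by (simp add: random_seq_def)
  qed auto
qed

section \<open>Occurrence counts over sets of rounds and their moments\<close>

definition hits :: "nat set \<Rightarrow> nat \<Rightarrow> (nat \<Rightarrow> nat) \<Rightarrow> real" where
  "hits P a v = (\<Sum>t\<in>P. of_bool (v t = a))"

lemma hits_nonneg: "hits P a v \<ge> 0"
  by (simp add: hits_def sum_nonneg)

lemma hits_le_card: "hits P a v \<le> card P"
  unfolding hits_def using sum_bounded_above[of P "\<lambda>t. of_bool (v t = a) :: real" 1] by simp

lemma measurable_hits [measurable]: "hits P a \<in> borel_measurable (random_seq n)"
  unfolding hits_def by measurable

text \<open>The count depends on the rounds of \<open>P\<close> only. This is recorded in the form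
  that independence of disjoint blocks requires: measurability over the coordinates in
  \<open>P\<close> and, in \<open>hits_restrict\<close>, invariance under restriction to
  \<open>P\<close>.\<close>

lemma measurable_hits_PiM:
  "hits P a \<in> borel_measurable (Pi\<^sub>M P (\<lambda>_. uniform_count_measure {1..n}))"
  unfolding hits_def
proof (rule borel_measurable_sum)
  fix t assume "t \<in> P"
  then show "(\<lambda>v. of_bool (v t = a)) \<in> borel_measurable (Pi\<^sub>M P (\<lambda>_. uniform_count_measure {1..n}))"
    by (rule measurable_compose[OF measurable_component_singleton])
       (simp add: measurable_def sets_uniform_count_measure space_uniform_count_measure)
qed

lemma hits_restrict: "hits P a (restrict v P) = hits P a v"
  by (simp add: hits_def cong: sum.cong)

lemma integrable_random_seq_bounded:
  assumes "n > 0" "f \<in> borel_measurable (random_seq n)" "\<And>v. \<bar>f v\<bar> \<le> (B :: real)"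
  shows "integrable (random_seq n) f"
proof -
  interpret prob_space "random_seq n" using prob_space_random_seq[OF assms(1)] .
  show ?thesis using assms by (intro integrable_const_bound[of _ B]) auto
qed

lemma integrable_hits: "n > 0 \<Longrightarrow> integrable (random_seq n) (hits P a)"
  by (rule integrable_random_seq_bounded[where B = "card P"])
     (auto simp: hits_nonneg hits_le_card abs_of_nonneg)

lemma integrable_hits_mult: "n > 0 \<Longrightarrow> integrable (random_seq n) (\<lambda>v. hits P a v * hits P b v)"
  by (rule integrable_random_seq_bounded[where B = "card P * card P"])
     (auto simp: abs_mult hits_nonneg hits_le_card abs_of_nonneg intro!: mult_mono)

lemma expectation_hits:
  assumes "n > 0" "a \<in> {1..n}"
  shows "(\<integral>v. hits P a v \<partial>random_seq n) = card P / n"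
proof -
  interpret prob_space "random_seq n" using prob_space_random_seq[OF assms(1)] .
  have *: "(\<integral>v. (of_bool (v t = a) :: real) \<partial>random_seq n) = 1 / n" for t
  proof -
    have "(\<integral>v. (of_bool (v t = a) :: real) \<partial>random_seq n) =
          (\<integral>v. indicator {v \<in> space (random_seq n). \<forall>s\<in>{t}. v s = a} v \<partial>random_seq n)"
      by (intro Bochner_Integration.integral_cong) (auto simp: indicator_def)
    also have "\<dots> = 1 / n"
      using prob_random_seq_cylinder[of n "{t}" "\<lambda>_. a"] assms by (simp add: Int_def conj_ac)
    finally show ?thesis .
  qed
  have "(\<integral>v. hits P a v \<partial>random_seq n) = (\<Sum>t\<in>P. \<integral>v. of_bool (v t = a) \<partial>random_seq n)"
    unfolding hits_def
    by (intro Bochner_Integration.integral_sum integrable_random_seq_bounded[OF assms(1), where B = 1]) auto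
  also have "\<dots> = card P / n" by (simp only: *) simp
  finally show ?thesis .
qed

lemma sum_of_bool_eq:
  assumes "finite A" "a \<in> A"
  shows "(\<Sum>b\<in>A. of_bool (a = b) * c) = (c :: real)"
proof -
  have "(\<Sum>b\<in>A. of_bool (a = b) * c) = (\<Sum>b\<in>A. if a = b then c else 0)"
    by (intro sum.cong) auto
  then show ?thesis using assms by simp
qed

text \<open>Expand the product over pairs of rounds \<open>(s, t)\<close>. Two distinct rounds
  contribute \<open>1 / n^2\<close>; a diagonal pair contributes \<open>1 / n\<close> if
  \<open>a = b\<close> and nothing otherwise. Granting the diagonal an extra \<open>1 / n^2\<close>
  completes the first part to a square.\<close>

lemma expectation_hits_mult_le:
  assumes "n > 0" "a \<in> {1..n}" "b \<in> {1..n}" "finite P"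
  shows "(\<integral>v. hits P a v * hits P b v \<partial>random_seq n) \<le> (card P / n)\<^sup>2 + of_bool (a = b) * (card P / n)"
proof -
  interpret prob_space "random_seq n" using prob_space_random_seq[OF assms(1)] .
  have *: "(\<integral>v. (of_bool (v s = a) * of_bool (v t = b) :: real) \<partial>random_seq n) \<le>
           (1 / n)\<^sup>2 + of_bool (s = t) * (of_bool (a = b) * (1 / n))" for s t
  proof -
    have "(\<integral>v. (of_bool (v s = a) * of_bool (v t = b) :: real) \<partial>random_seq n) =
          (\<integral>v. indicator {v \<in> space (random_seq n). v s = a \<and> v t = b} v \<partial>random_seq n)"
      by (intro Bochner_Integration.integral_cong) (auto simp: indicator_def)
    also have "\<dots> = prob {v \<in> space (random_seq n). v s = a \<and> v t = b}"
      by (simp add: Int_def conj_ac)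
    also have "\<dots> \<le> (1 / n)\<^sup>2 + of_bool (s = t) * (of_bool (a = b) * (1 / n))"
    proof (cases "s = t")
      case True
      then show ?thesis
        using prob_random_seq_cylinder[of n "{t}" "\<lambda>_. a"] assms 
        by (cases "a = b") (auto cong: conj_cong)
    next
      case False
      then have eq: "{v \<in> space (random_seq n). \<forall>u\<in>{s, t}. v u = (if u = s then a else b)} =
                 {v \<in> space (random_seq n). v s = a \<and> v t = b}" by auto
      show ?thesis
        using prob_random_seq_cylinder[of n "{s, t}" "\<lambda>u. if u = s then a else b"] assms False
        unfolding eq by (simp add: power2_eq_square)
    qed
    finally show ?thesis .
  qed
  have "(\<integral>v. hits P a v * hits P b v \<partial>random_seq n) =
        (\<Sum>s\<in>P. \<Sum>t\<in>P. \<integral>v. (of_bool (v s = a) * of_bool (v t = b) :: real) \<partial>random_seq n)"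
    unfolding hits_def sum_product
    by (subst Bochner_Integration.integral_sum; (intro sum.cong refl Bochner_Integration.integral_sum Bochner_Integration.integrable_sum)?;
        (intro integrable_random_seq_bounded[OF assms(1), where B = 1])?) auto
  also have "\<dots> \<le> (\<Sum>s\<in>P. \<Sum>t\<in>P. (1 / n)\<^sup>2 + of_bool (s = t) * (of_bool (a = b) * (1 / n)))"
    by (intro sum_mono *)
  also have "\<dots> = (\<Sum>s\<in>P. card P * (1 / n)\<^sup>2 + of_bool (a = b) * (1 / n))"
    using \<open>finite P\<close> by (intro sum.cong refl) (simp only: sum.distrib sum_of_bool_eq, simp)
  also have "\<dots> = (card P / n)\<^sup>2 + of_bool (a = b) * (card P / n)"
    by (simp add: power2_eq_square algebra_simps)
  finally show ?thesis .
qed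

text \<open>Functions of disjoint blocks of independent coordinates are independent, so the
  expectation factors. That \<open>F j\<close> depends on the block \<open>P j\<close> alone is
  expressed by its invariance under \<open>restrict\<close>.\<close>

lemma expectation_prod_blocks:
  fixes F :: "'j \<Rightarrow> (nat \<Rightarrow> nat) \<Rightarrow> real"
  assumes "n > 0" "finite J" "disjoint_family_on P J"
    and "\<And>j. j \<in> J \<Longrightarrow> F j \<in> borel_measurable (Pi\<^sub>M (P j) (\<lambda>_. uniform_count_measure {1..n}))"
    and "\<And>j v. j \<in> J \<Longrightarrow> F j (restrict v (P j)) = F j v"
    and "\<And>j. j \<in> J \<Longrightarrow> integrable (random_seq n) (F j)"
  shows "(\<integral>v. (\<Prod>j\<in>J. F j v) \<partial>random_seq n) = (\<Prod>j\<in>J. \<integral>v. F j v \<partial>random_seq n)"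
proof -
  interpret prob_space "random_seq n" using prob_space_random_seq[OF assms(1)] .
  have "indep_vars (\<lambda>j. Pi\<^sub>M (P j) (\<lambda>_. uniform_count_measure {1..n})) (\<lambda>j v. restrict (\<lambda>t. v t) (P j)) J"
    by (rule indep_vars_restrict[OF indep_vars_random_seq[OF assms(1)]]) (use assms in auto)
  then have "indep_vars (\<lambda>_. borel) (\<lambda>j v. F j (restrict (\<lambda>t. v t) (P j))) J"
    by (rule indep_vars_compose2) (use assms in auto)
  then have "indep_vars (\<lambda>_. borel) F J"
    by (rule indep_vars_cong[THEN iffD1, rotated -1]) (use assms(5) in auto)
  then show ?thesis
    by (rule indep_vars_lebesgue_integral[OF assms(2)]) (use assms in auto)
qed


text \<open>
  Chebyshev's inequality for the number of pairs \<open>(a, t)\<close> with \<open>a \<in> A\<close>, \<open>t j \<in> P j\<close> and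
  \<open>v (t j) = a\<close> for all \<open>j\<close>, written as a sum over \<open>a\<close> of products of independent variables.
\<close>

lemma prob_no_common_hit_le:
  assumes "n > 0" "finite J" "disjoint_family_on P J" "\<And>j. j \<in> J \<Longrightarrow> finite (P j) \<and> card (P j) = L"
    and "L \<le> n" "A \<subseteq> {1..n}" and \<mu>: "\<mu> = card A * (L / n) ^ card J" "\<mu> > 0"
  shows "measure (random_seq n) {v \<in> space (random_seq n). \<not> (\<exists>a\<in>A. \<forall>j\<in>J. \<exists>t\<in>P j. v t = a)} \<le> 2 ^ card J / \<mu>"
proof -
  interpret prob_space "random_seq n" using prob_space_random_seq[OF assms(1)] .
  define x where "x = real L / real n"
  have x: "0 \<le> x" "x \<le> 1" using assms by (auto simp: x_def)
  have "finite A" using assms finite_subset by blast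
  define X where "X v = (\<Sum>a\<in>A. \<Prod>j\<in>J. hits (P j) a v)" for v
  have [measurable]: "X \<in> borel_measurable (random_seq n)" unfolding X_def by measurable
  have X_le: "\<bar>X v\<bar> \<le> card A * L ^ card J" for v
  proof -
    have "(\<Prod>j\<in>J. hits (P j) a v) \<le> (\<Prod>j\<in>J. L)" for a
      unfolding of_nat_prod using assms(4) hits_le_card[of "P _" a v]
      by (intro prod_mono) (auto simp: hits_nonneg)
    then have "X v \<le> card A * L ^ card J"
      unfolding X_def using sum_bounded_above[of A "\<lambda>a. \<Prod>j\<in>J. hits (P j) a v" "L ^ card J"] by simp
    moreover have "X v \<ge> 0" unfolding X_def by (intro sum_nonneg prod_nonneg ballI hits_nonneg)
    ultimately show ?thesis by simp
  qed
  have int: "integrable (random_seq n) (\<lambda>v. \<Prod>j\<in>J. hits (P j) a v)" for a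
    by (rule integrable_random_seq_bounded[OF assms(1), where B = "\<Prod>j\<in>J. card (P j)"])
       (auto simp: abs_prod hits_nonneg hits_le_card intro!: prod_mono)
  have int2: "integrable (random_seq n) (\<lambda>v. \<Prod>j\<in>J. hits (P j) a v * hits (P j) b v)" for a b
    by (rule integrable_random_seq_bounded[OF assms(1), where B = "\<Prod>j\<in>J. card (P j) * card (P j)"])
       (auto simp: abs_prod abs_mult hits_nonneg hits_le_card intro!: prod_mono mult_mono)
  have intX: "integrable (random_seq n) X" "integrable (random_seq n) (\<lambda>v. (X v)\<^sup>2)"
    using X_le power_mono[OF X_le abs_ge_zero, of _ 2]
    by (auto intro!: integrable_random_seq_bounded[OF assms(1)])
  have EX: "expectation X = \<mu>"
  proof -
    have "expectation (\<lambda>v. \<Prod>j\<in>J. hits (P j) a v) = x ^ card J" if "a \<in> A" for a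
    proof -
      have "expectation (\<lambda>v. \<Prod>j\<in>J. hits (P j) a v) = (\<Prod>j\<in>J. expectation (hits (P j) a))"
        using assms(1-4) by (intro expectation_prod_blocks[where P = P])
          (auto simp: integrable_hits measurable_hits_PiM hits_restrict simp del: One_nat_def)
      also have "\<dots> = (\<Prod>j\<in>J. x)"
        using that assms by (intro prod.cong refl) (auto simp: expectation_hits x_def)
      finally show ?thesis by simp
    qed
    then show ?thesis unfolding X_def by (simp add: int Bochner_Integration.integral_sum \<mu> x_def)
  qed
  have "expectation (\<lambda>v. (X v)\<^sup>2) = (\<Sum>a\<in>A. \<Sum>b\<in>A. expectation (\<lambda>v. \<Prod>j\<in>J. hits (P j) a v * hits (P j) b v))"
    unfolding X_def power2_eq_square sum_product prod.distrib[symmetric]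
    by (simp add: int2 Bochner_Integration.integral_sum)
  \<comment> \<open>For \<open>a \<noteq> b\<close> the bound is the product of the two means, so
    only the diagonal contributes to the variance bound.\<close>
  also have "\<dots> \<le> (\<Sum>a\<in>A. \<Sum>b\<in>A. (x\<^sup>2) ^ card J + of_bool (a = b) * (2 * x) ^ card J)"
  proof (intro sum_mono)
    fix a b assume ab: "a \<in> A" "b \<in> A"
    have "expectation (\<lambda>v. \<Prod>j\<in>J. hits (P j) a v * hits (P j) b v) =
          (\<Prod>j\<in>J. expectation (\<lambda>v. hits (P j) a v * hits (P j) b v))"
      using assms(1-4) by (intro expectation_prod_blocks[where P = P])
        (auto simp: integrable_hits_mult hits_restrict simp del: One_nat_def intro!: borel_measurable_times measurable_hits_PiM)
    also have "\<dots> \<le> (\<Prod>j\<in>J. x\<^sup>2 + of_bool (a = b) * x)"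
    proof (intro prod_mono conjI)
      fix j assume "j \<in> J"
      then show "expectation (\<lambda>v. hits (P j) a v * hits (P j) b v) \<le> x\<^sup>2 + of_bool (a = b) * x"
        using expectation_hits_mult_le[of n a b "P j"] assms(1,4,6) ab by (auto simp: x_def subset_iff)
    qed (auto intro!: integral_nonneg_AE simp: hits_nonneg)
    also have "\<dots> = (x\<^sup>2 + of_bool (a = b) * x) ^ card J" by simp
    also have "\<dots> \<le> (x\<^sup>2) ^ card J + of_bool (a = b) * (2 * x) ^ card J"
    proof (cases "a = b")
      case True
      \<comment> \<open>The factor \<open>2 ^ card J\<close> arises here: \<open>L \<le> n\<close>
        gives \<open>x \<le> 1\<close>, so the quadratic term is at most the linear one.\<close>
      have "x\<^sup>2 \<le> x" using x by (simp add: power2_eq_square mult_left_le)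
      then have "(x\<^sup>2 + x) ^ card J \<le> (2 * x) ^ card J" using x by (intro power_mono) auto
      then show ?thesis using True by (simp add: add_increasing)
    qed simp
    finally show "expectation (\<lambda>v. \<Prod>j\<in>J. hits (P j) a v * hits (P j) b v) \<le>
       (x\<^sup>2) ^ card J + of_bool (a = b) * (2 * x) ^ card J" .
  qed
  also have "\<dots> = (\<Sum>a\<in>A. card A * (x\<^sup>2) ^ card J + (2 * x) ^ card J)"
    using \<open>finite A\<close> by (intro sum.cong refl) (simp add: sum.distrib sum_of_bool_eq)
  also have "\<dots> = \<mu>\<^sup>2 + 2 ^ card J * \<mu>"
    unfolding \<mu> x_def[symmetric] by (simp add: power2_eq_square power_mult_distrib algebra_simps)
  finally have var: "variance X \<le> 2 ^ card J * \<mu>"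
    using variance_eq[OF intX] EX by simp
  \<comment> \<open>If no vertex of \<open>A\<close> occurs in every block, each product has a
    vanishing factor; then \<open>X v = 0\<close>, which differs from the expectation by the full
    mean \<mu>.\<close>
  have "{v \<in> space (random_seq n). \<not> (\<exists>a\<in>A. \<forall>j\<in>J. \<exists>t\<in>P j. v t = a)} \<subseteq>
        {v \<in> space (random_seq n). \<bar>X v - expectation X\<bar> \<ge> \<mu>}"
  proof (safe, unfold EX)
    fix v assume none: "\<not> (\<exists>a\<in>A. \<forall>j\<in>J. \<exists>t\<in>P j. v t = a)"
    have "(\<Prod>j\<in>J. hits (P j) a v) = 0" if a: "a \<in> A" for a
    proof -
      obtain j where j: "j \<in> J" "\<forall>t\<in>P j. v t \<noteq> a" using none a by blast
      then have "hits (P j) a v = 0" by (simp add: hits_def)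
      then show ?thesis using j(1) assms(2) by (intro prod_zero) auto
    qed
    then have "X v = 0" by (simp add: X_def)
    then show "\<mu> \<le> \<bar>X v - \<mu>\<bar>" by simp
  qed
  then have "prob {v \<in> space (random_seq n). \<not> (\<exists>a\<in>A. \<forall>j\<in>J. \<exists>t\<in>P j. v t = a)} \<le>
        prob {v \<in> space (random_seq n). \<bar>X v - expectation X\<bar> \<ge> \<mu>}"
    by (intro finite_measure_mono) auto
  also have "\<dots> \<le> variance X / \<mu>\<^sup>2"
    using intX \<mu>(2) by (intro Chebyshev_inequality) auto
  also have "\<dots> \<le> 2 ^ card J * \<mu> / \<mu>\<^sup>2" by (intro divide_right_mono var) auto
  also have "\<dots> = 2 ^ card J / \<mu>" using \<mu>(2) by (simp add: power2_eq_square)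
  finally show ?thesis .
qed

section \<open>The law of the process\<close>

lemma random_seq_in_prob_algebra:
  "n > 0 \<Longrightarrow> random_seq n \<in> space (prob_algebra (vertex_seqs n))"
  by (simp add: space_prob_algebra sets_random_seq prob_space_random_seq)

text \<open>This kernel sends \<open>v\<close> to the law of the pair \<open>(v, u)\<close>; its
  measurability is what the rules for \<open>bind\<close> require in order to handle
  \<open>process_law\<close>.\<close>

lemma vertex_seqs_kernel:
  assumes "S \<in> strategies n"
  shows "(\<lambda>v. S v \<bind> (\<lambda>u. return (vertex_seqs n \<Otimes>\<^sub>M vertex_seqs n) (v, u)))
     \<in> vertex_seqs n \<rightarrow>\<^sub>M prob_algebra (vertex_seqs n \<Otimes>\<^sub>M vertex_seqs n)"
proof -
  note [measurable] = assms[unfolded strategies_def]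
  show ?thesis by measurable
qed

lemma
  assumes "n > 0" "S \<in> strategies n"
  shows prob_space_process_law: "prob_space (process_law n S)"
    and sets_process_law: "sets (process_law n S) = sets (vertex_seqs n \<Otimes>\<^sub>M vertex_seqs n)"
    and space_process_law: "space (process_law n S) = space (vertex_seqs n) \<times> space (vertex_seqs n)"
proof -
  show "prob_space (process_law n S)"
    unfolding process_law_def
    by (rule prob_space_bind'[OF random_seq_in_prob_algebra[OF assms(1)] vertex_seqs_kernel[OF assms(2)]])
  show *: "sets (process_law n S) = sets (vertex_seqs n \<Otimes>\<^sub>M vertex_seqs n)"
    unfolding process_law_def
    by (rule sets_bind'[OF random_seq_in_prob_algebra[OF assms(1)] vertex_seqs_kernel[OF assms(2)]])
  show "space (process_law n S) = space (vertex_seqs n) \<times> space (vertex_seqs n)"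
    using sets_eq_imp_space_eq[OF *] by (simp add: space_pair_measure)
qed

text \<open>Whatever the strategy does, the first marginal of \<open>process_law n S\<close> is
  \<open>random_seq n\<close>. Hence a condition on the offered vertices that success forces bounds
  the success probability of all strategies alike.\<close>

lemma success_prob_le:
  assumes "n > 0" "S \<in> strategies n"
    and B [measurable]: "Measurable.pred (vertex_seqs n) B"
    and imp: "\<And>v u. (\<And>t. v t \<in> {1..n}) \<Longrightarrow> (\<And>t. u t \<in> {1..n}) \<Longrightarrow> P (builder_graph n m v u) \<Longrightarrow> B v"
  shows "success_prob P n S m \<le> measure (random_seq n) {v \<in> space (random_seq n). B v}"
proof -
  interpret prob_space "process_law n S" using prob_space_process_law[OF assms(1,2)] .
  interpret R: prob_space "random_seq n" using prob_space_random_seq[OF assms(1)] .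
  have [measurable_cong]: "sets (process_law n S) = sets (vertex_seqs n \<Otimes>\<^sub>M vertex_seqs n)"
    using sets_process_law[OF assms(1,2)] .
  define X where "X = {x \<in> space (vertex_seqs n \<Otimes>\<^sub>M vertex_seqs n). B (fst x)}"
  have X: "X \<in> sets (vertex_seqs n \<Otimes>\<^sub>M vertex_seqs n)" unfolding X_def by measurable
  have "success_prob P n S m \<le> prob X"
    unfolding success_prob_def
  proof (rule finite_measure_mono)
    show "{(v, u) \<in> space (process_law n S). P (builder_graph n m v u)} \<subseteq> X"
    proof clarify
      fix v u assume vu: "(v, u) \<in> space (process_law n S)" "P (builder_graph n m v u)"
      then have "B v" by (intro imp[of v u]) (auto simp: space_process_law[OF assms(1,2)] space_vertex_seqs)
      then show "(v, u) \<in> X"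
        using vu by (simp add: X_def space_process_law[OF assms(1,2)] space_pair_measure)
    qed
  qed (simp add: X sets_process_law[OF assms(1,2)])
  also have "\<dots> \<le> R.prob {v \<in> space (random_seq n). B v}"
  proof -
    have "emeasure (process_law n S) X =
       (\<integral>\<^sup>+v. emeasure (S v \<bind> (\<lambda>u. return (vertex_seqs n \<Otimes>\<^sub>M vertex_seqs n) (v, u))) X \<partial>random_seq n)"
      unfolding process_law_def
      by (rule emeasure_bind_prob_algebra[OF random_seq_in_prob_algebra[OF assms(1)] vertex_seqs_kernel[OF assms(2)] X])
    also have "\<dots> \<le> (\<integral>\<^sup>+v. indicator {v \<in> space (random_seq n). B v} v \<partial>random_seq n)"
    proof (rule nn_integral_mono)
      fix v assume v: "v \<in> space (random_seq n)"
      then have v': "v \<in> space (vertex_seqs n)" by (simp add: space_random_seq space_vertex_seqs)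
      let ?K = "\<lambda>u. return (vertex_seqs n \<Otimes>\<^sub>M vertex_seqs n) (v, u)"
      have Sv: "S v \<in> space (prob_algebra (vertex_seqs n))"
        using assms(2) v' unfolding strategies_def by (rule measurable_space)
      then have sp: "space (S v) = space (vertex_seqs n)"
        by (auto simp: space_prob_algebra dest: sets_eq_imp_space_eq)
      interpret Sv: prob_space "S v" using Sv by (simp add: space_prob_algebra)
      have K: "?K \<in> vertex_seqs n \<rightarrow>\<^sub>M prob_algebra (vertex_seqs n \<Otimes>\<^sub>M vertex_seqs n)"
        using v' by measurable
      \<comment> \<open>Given \<open>v\<close>, all mass lies on pairs with first component
        \<open>v\<close>, and whether such a pair is in \<open>X\<close> depends on
        \<open>B v\<close> alone; so the inner integral is 0 or 1.\<close>
      have "emeasure (S v \<bind> ?K) X = (\<integral>\<^sup>+u. indicator X (v, u) \<partial>S v)"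
        using X by (subst emeasure_bind_prob_algebra[OF Sv K X]) simp
      also have "\<dots> = (\<integral>\<^sup>+u. indicator {v \<in> space (random_seq n). B v} v \<partial>S v)"
        using v v' sp by (intro nn_integral_cong) (auto simp: X_def indicator_def space_pair_measure)
      also have "\<dots> = indicator {v \<in> space (random_seq n). B v} v"
        by (simp add: Sv.emeasure_space_1)
      finally show "emeasure (S v \<bind> ?K) X \<le> indicator {v \<in> space (random_seq n). B v} v" by simp
    qed
    also have "\<dots> = emeasure (random_seq n) {v \<in> space (random_seq n). B v}"
      by (intro nn_integral_indicator) measurable
    finally show ?thesis by (simp add: emeasure_eq_measure R.emeasure_eq_measure)
  qed
  finally show ?thesis .
qed

section \<open>Measurability of containing a copy, and deterministic strategies\<close>

lemma fst_builder_graph [simp]: "fst (builder_graph n m v u) = {1..n}"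
  by (simp add: builder_graph_def)

lemma in_edges_builder_graph_iff [simp]:
  "e \<in># snd (builder_graph n m v u) \<longleftrightarrow> (\<exists>t<m. {u t, v t} = e)"
  by (auto simp: builder_graph_def)

text \<open>Cutting the embedding down to an extensional function on \<open>V\<close> leaves
  finitely many candidates. Containing a copy thus becomes a finite combination of conditions on
  single rounds, from which measurability follows.\<close>

lemma contains_copy_builder_graph_iff:
  assumes "finite V" "E \<subseteq> Pow V"
  shows "contains_copy V E (builder_graph n m v u) \<longleftrightarrow>
    (\<exists>\<phi> \<in> {\<phi> \<in> V \<rightarrow>\<^sub>E {1..n}. inj_on \<phi> V}. \<forall>e\<in>E. \<exists>t<m. {u t, v t} = \<phi> ` e)"
proof
  assume "contains_copy V E (builder_graph n m v u)"
  then obtain \<phi> where \<phi>: "inj_on \<phi> V" "\<phi> ` V \<subseteq> {1..n}" "\<forall>e\<in>E. \<exists>t<m. {u t, v t} = \<phi> ` e"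
    by (auto simp: contains_copy_def)
  have "restrict \<phi> V ` e = \<phi> ` e" if "e \<in> E" for e
    using assms(2) that by (intro image_cong) auto
  then show "\<exists>\<phi> \<in> {\<phi> \<in> V \<rightarrow>\<^sub>E {1..n}. inj_on \<phi> V}. \<forall>e\<in>E. \<exists>t<m. {u t, v t} = \<phi> ` e"
    using \<phi> by (intro bexI[of _ "restrict \<phi> V"]) (auto simp: inj_on_def)
next
  assume "\<exists>\<phi> \<in> {\<phi> \<in> V \<rightarrow>\<^sub>E {1..n}. inj_on \<phi> V}. \<forall>e\<in>E. \<exists>t<m. {u t, v t} = \<phi> ` e"
  then obtain \<phi> where \<phi>: "\<phi> \<in> V \<rightarrow>\<^sub>E {1..n}" "inj_on \<phi> V" "\<forall>e\<in>E. \<exists>t<m. {u t, v t} = \<phi> ` e"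
    by blast
  moreover have "\<phi> ` V \<subseteq> {1..n}" using PiE_mem[OF \<phi>(1)] by blast
  ultimately show "contains_copy V E (builder_graph n m v u)"
    unfolding contains_copy_def fst_builder_graph in_edges_builder_graph_iff by blast
qed

lemma measurable_contains_copy:
  assumes "finite V" "E \<subseteq> Pow V"
  shows "Measurable.pred (vertex_seqs n \<Otimes>\<^sub>M vertex_seqs n)
    (\<lambda>x. contains_copy V E (builder_graph n m (fst x) (snd x)))"
proof -
  have fin: "finite {\<phi> \<in> V \<rightarrow>\<^sub>E {1..n}. inj_on \<phi> V}"
    using finite_PiE[of V "\<lambda>_. {1..n}"] assms by simp
  have "finite E" using assms by (meson finite_Pow_iff finite_subset)
  have m: "(\<lambda>x. (snd x t, fst x t)) \<in> (vertex_seqs n \<Otimes>\<^sub>M vertex_seqs n) \<rightarrow>\<^sub>M count_space ({1..n} \<times> {1..n})" for t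
    by (subst pair_measure_countable[symmetric]; (simp; fail)?) measurable
  have "Measurable.pred (vertex_seqs n \<Otimes>\<^sub>M vertex_seqs n) (\<lambda>x. {snd x t, fst x t} = c)" for t c
    using measurable_compose[OF m[of t], of "\<lambda>(a, b). {a, b} = c" "count_space UNIV"] by simp
  then show ?thesis
    unfolding contains_copy_builder_graph_iff[OF assms]
    using fin \<open>finite E\<close>
    by (intro pred_intros_finite) auto
qed

text \<open>
  Builder answers by a fixed choice depending on the first \<open>m\<close> offered vertices only, so that
  measurability of the strategy is automatic.
\<close>

lemma ex_strategy_success_prob_ge:
  assumes "n > 0" "finite V" "E \<subseteq> Pow V"
    and B [measurable]: "Measurable.pred (vertex_seqs n) B"
    and imp: "\<And>v. (\<And>t. v t \<in> {1..n}) \<Longrightarrow> B v \<Longrightarrow>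
      \<exists>u. (\<forall>t. u t \<in> {1..n}) \<and> contains_copy V E (builder_graph n m v u)"
  shows "\<exists>S \<in> strategies n.
    success_prob (contains_copy V E) n S m \<ge> measure (random_seq n) {v \<in> space (random_seq n). B v}"
proof -
  define Q where "Q w u \<longleftrightarrow> (\<forall>t. u t \<in> {1..n}) \<and> contains_copy V E (builder_graph n m w u)" for w u
  have Q_cong: "Q (restrict v {..<m}) u \<longleftrightarrow> Q v u" for v u
  proof -
    have "builder_graph n m (restrict v {..<m}) u = builder_graph n m v u"
      unfolding builder_graph_def by (intro arg_cong2[where f = Pair] image_mset_cong refl) simp
    then show ?thesis by (simp add: Q_def)
  qed
  \<comment> \<open>The constant reply 1 is the default when no winning reply exists; as
    \<open>n > 0\<close>, it is a legal vertex.\<close>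
  define \<Psi> where "\<Psi> w = (if \<exists>u. Q w u then SOME u. Q w u else (\<lambda>_. 1))" for w :: "nat \<Rightarrow> nat"
  have \<Psi>: "\<Psi> w t \<in> {1..n}" for w t
  proof (cases "\<exists>u. Q w u")
    case True
    then have "Q w (\<Psi> w)" unfolding \<Psi>_def by (simp add: someI_ex)
    then show ?thesis by (simp add: Q_def)
  qed (use \<open>n > 0\<close> in \<open>simp add: \<Psi>_def\<close>)
  define \<sigma> where "\<sigma> v = \<Psi> (restrict v {..<m})" for v
  have \<sigma>: "contains_copy V E (builder_graph n m v (\<sigma> v))" if "\<And>t. v t \<in> {1..n}" "B v" for v
  proof -
    have "\<exists>u. Q (restrict v {..<m}) u" unfolding Q_cong using imp[OF that] by (auto simp: Q_def)
    then have "Q (restrict v {..<m}) (\<sigma> v)" unfolding \<sigma>_def \<Psi>_def by (simp add: someI_ex)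
    then show ?thesis unfolding Q_cong by (simp add: Q_def)
  qed
  \<comment> \<open>The restrictions to the first \<open>m\<close> rounds lie in a finite set with
    the discrete sigma-algebra, so a choice function on them is measurable as soon as its values are
    legal.\<close>
  have m1: "(\<lambda>v. restrict v {..<m}) \<in> vertex_seqs n \<rightarrow>\<^sub>M count_space ({..<m} \<rightarrow>\<^sub>E {1..n})"
    unfolding vertex_seqs_def
    by (subst count_space_PiM_finite[symmetric]) (auto intro!: measurable_restrict_subset simp del: One_nat_def)
  have m2: "\<Psi> \<in> count_space ({..<m} \<rightarrow>\<^sub>E {1..n}) \<rightarrow>\<^sub>M vertex_seqs n"
    using \<Psi> by (auto simp: space_vertex_seqs)
  have \<sigma>_meas [measurable]: "\<sigma> \<in> vertex_seqs n \<rightarrow>\<^sub>M vertex_seqs n"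
    unfolding \<sigma>_def by (rule measurable_compose[OF m1 m2])
  define S where "S v = return (vertex_seqs n) (\<sigma> v)" for v
  have S: "S \<in> strategies n" unfolding strategies_def S_def by measurable
  interpret prob_space "random_seq n" using prob_space_random_seq[OF assms(1)] .
  have pair [measurable]: "(\<lambda>v. (v, \<sigma> v)) \<in> random_seq n \<rightarrow>\<^sub>M vertex_seqs n \<Otimes>\<^sub>M vertex_seqs n"
    by measurable
  \<comment> \<open>Under a deterministic strategy the process law is the image of
    \<open>random_seq n\<close> under \<open>v \<mapsto> (v, \<sigma> v)\<close>, so success becomes
    an event about \<open>v\<close> alone.\<close>
  have law: "process_law n S = distr (random_seq n) (vertex_seqs n \<Otimes>\<^sub>M vertex_seqs n) (\<lambda>v. (v, \<sigma> v))"
  proof -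
    have "process_law n S = random_seq n \<bind> (\<lambda>v. return (vertex_seqs n \<Otimes>\<^sub>M vertex_seqs n) (v, \<sigma> v))"
      unfolding process_law_def S_def
    proof (rule bind_cong[OF refl])
      fix v assume "v \<in> space (random_seq n)"
      then have v: "v \<in> space (vertex_seqs n)" by (simp add: space_random_seq space_vertex_seqs)
      show "return (vertex_seqs n) (\<sigma> v) \<bind> (\<lambda>u. return (vertex_seqs n \<Otimes>\<^sub>M vertex_seqs n) (v, u)) =
            return (vertex_seqs n \<Otimes>\<^sub>M vertex_seqs n) (v, \<sigma> v)"
        using v measurable_space[OF \<sigma>_meas v]
        by (intro bind_return[where N = "vertex_seqs n \<Otimes>\<^sub>M vertex_seqs n"]) measurable
    qed
    also have "\<dots> = distr (random_seq n) (vertex_seqs n \<Otimes>\<^sub>M vertex_seqs n) (\<lambda>v. (v, \<sigma> v))"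
      by (rule bind_return_distr'[OF not_empty pair])
    finally show ?thesis .
  qed
  have [measurable]: "Measurable.pred (vertex_seqs n \<Otimes>\<^sub>M vertex_seqs n)
    (\<lambda>x. contains_copy V E (builder_graph n m (fst x) (snd x)))"
    using measurable_contains_copy[OF assms(2,3)] .
  have "success_prob (contains_copy V E) n S m =
    measure (process_law n S) {x \<in> space (vertex_seqs n \<Otimes>\<^sub>M vertex_seqs n).
      contains_copy V E (builder_graph n m (fst x) (snd x))}"
    unfolding success_prob_def law by (simp add: case_prod_beta' Collect_conj_eq)
  also have "\<dots> = prob {v \<in> space (random_seq n). contains_copy V E (builder_graph n m v (\<sigma> v))}"
    unfolding law using measurable_space[OF pair]
    by (subst measure_distr) (auto intro!: arg_cong[where f = prob])
  also have "\<dots> \<ge> prob {v \<in> space (random_seq n). B v}"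
  proof (rule finite_measure_mono)
    show "{v \<in> space (random_seq n). B v} \<subseteq>
          {v \<in> space (random_seq n). contains_copy V E (builder_graph n m v (\<sigma> v))}"
      using \<sigma> by (auto simp: space_random_seq)
    have "Measurable.pred (random_seq n) (\<lambda>v. contains_copy V E (builder_graph n m (fst (v, \<sigma> v)) (snd (v, \<sigma> v))))"
      by measurable
    then show "{v \<in> space (random_seq n). contains_copy V E (builder_graph n m v (\<sigma> v))} \<in> events"
      by (simp add: pred_def)
  qed
  finally show ?thesis using S by blast
qed

section \<open>Orientations and copies\<close>

lemma orientation_subset:
  assumes "simple_graph V E" "orientation E D"
  shows "D \<subseteq> V \<times> V"
  using assms by (fastforce simp: simple_graph_def orientation_def)

text \<open>Together with \<open>ex_orientation\<close> this shows that the \<open>Min\<close> in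
  \<open>min_max_out_degree\<close> is taken over a finite nonempty set, hence attained.\<close>

lemma finite_orientations:
  assumes "simple_graph V E" shows "finite {D. orientation E D}"
proof (rule finite_subset)
  show "{D. orientation E D} \<subseteq> Pow (V \<times> V)" using orientation_subset[OF assms] by blast
  show "finite (Pow (V \<times> V))" using assms by (simp add: simple_graph_def)
qed

text \<open>Number the vertices injectively and direct every edge towards its larger number.\<close>

lemma ex_orientation:
  assumes "simple_graph V E" shows "\<exists>D. orientation E D"
proof -
  obtain h :: "'a \<Rightarrow> nat" where h: "inj_on h V"
    using assms finite_imp_inj_to_nat_seg[of V] by (auto simp: simple_graph_def)
  have "orientation E {(x, y). {x, y} \<in> E \<and> h x < h y}"
    unfolding orientation_def
  proof (intro conjI allI impI)
    fix x y assume e: "{x, y} \<in> E"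
    then have "x \<noteq> y" "x \<in> V" "y \<in> V" using assms by (auto simp: simple_graph_def)
    then have "h x \<noteq> h y" using h by (auto dest: inj_onD)
    then show "((x, y) \<in> {(x, y). {x, y} \<in> E \<and> h x < h y}) \<noteq> ((y, x) \<in> {(x, y). {x, y} \<in> E \<and> h x < h y})"
      using e by (auto simp: insert_commute)
  qed auto
  then show ?thesis by blast
qed

lemma card_out_le_max_out_degree:
  "finite V \<Longrightarrow> x \<in> V \<Longrightarrow> card (D `` {x}) \<le> max_out_degree V D"
  unfolding max_out_degree_def by (intro Max_ge) auto

lemma ex_card_out_eq_max_out_degree:
  assumes "finite V" "V \<noteq> {}" shows "\<exists>x\<in>V. card (D `` {x}) = max_out_degree V D"
proof -
  have "max_out_degree V D \<in> (\<lambda>x. card (D `` {x})) ` V"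
    unfolding max_out_degree_def using assms by (intro Max_in) auto
  then show ?thesis by auto
qed

lemma min_max_out_degree_le:
  assumes "simple_graph V E" "orientation E D"
  shows "min_max_out_degree V E \<le> max_out_degree V D"
  unfolding min_max_out_degree_def using finite_orientations[OF assms(1)] assms(2)
  by (intro Min_le) auto

lemma ex_optimal_orientation:
  assumes "simple_graph V E"
  shows "\<exists>D. orientation E D \<and> max_out_degree V D = min_max_out_degree V E"
proof -
  have "min_max_out_degree V E \<in> max_out_degree V ` {D. orientation E D}"
    unfolding min_max_out_degree_def using finite_orientations[OF assms] ex_orientation[OF assms]
    by (intro Min_in) auto
  then show ?thesis by auto
qed

lemma simple_graph_nonempty: "simple_graph V E \<Longrightarrow> E \<noteq> {} \<Longrightarrow> V \<noteq> {}"
  by (fastforce simp: simple_graph_def)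

text \<open>Any edge gives its tail out-degree at least 1. Positivity of \<open>r\<close> keeps the
  exponent \<open>(r - 1) / r\<close> meaningful.\<close>

lemma min_max_out_degree_pos:
  assumes "simple_graph V E" "E \<noteq> {}"
  shows "min_max_out_degree V E > 0"
proof -
  obtain D where D: "orientation E D" "max_out_degree V D = min_max_out_degree V E"
    using ex_optimal_orientation[OF assms(1)] by blast
  have fin: "finite V" using assms by (simp add: simple_graph_def)
  obtain e where "e \<in> E" using assms by blast
  then obtain x y where "{x, y} \<in> E" using assms(1) by (auto simp: simple_graph_def card_2_iff)
  then obtain x y where xy: "(x, y) \<in> D" using D(1) unfolding orientation_def by blast
  have sub: "D \<subseteq> V \<times> V" using orientation_subset[OF assms(1) D(1)] .
  then have "finite (D `` {x})" by (intro finite_subset[OF _ fin]) auto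
  then have "0 < card (D `` {x})" using xy by (auto simp: card_gt_0_iff)
  also have "\<dots> \<le> max_out_degree V D"
    using sub xy by (intro card_out_le_max_out_degree fin) auto
  finally show ?thesis using D by simp
qed

text \<open>Let each edge of the copy point away from the vertex offered in a round that drew it.
  The out-edges of \<open>x\<close> then come from different rounds, all offering the image of
  \<open>x\<close>, and some \<open>x\<close> has at least \<open>min_max_out_degree V E\<close> of
  them.\<close>

lemma contains_copy_imp_popular_vertex:
  assumes G: "simple_graph V E" "E \<noteq> {}" and copy: "contains_copy V E (builder_graph n m v u)"
  shows "\<exists>a\<in>{1..n}. min_max_out_degree V E \<le> card {t \<in> {..<m}. v t = a}"
proof -
  obtain \<phi> where \<phi>: "inj_on \<phi> V" "\<phi> ` V \<subseteq> {1..n}" "\<forall>e\<in>E. \<exists>t<m. {u t, v t} = \<phi> ` e"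
    using copy by (auto simp: contains_copy_def)
  then obtain T where T: "\<And>e. e \<in> E \<Longrightarrow> T e < m \<and> {u (T e), v (T e)} = \<phi> ` e" by metis
  define D where "D = {(x, y). {x, y} \<in> E \<and> v (T {x, y}) = \<phi> x}"
  have "orientation E D"
    unfolding orientation_def
  proof (intro conjI allI impI)
    fix x y assume e: "{x, y} \<in> E"
    then have "x \<noteq> y" "x \<in> V" "y \<in> V" using G by (auto simp: simple_graph_def)
    then have "\<phi> x \<noteq> \<phi> y" using \<phi>(1) by (auto dest: inj_onD)
    \<comment> \<open>The offered vertex is one of the two distinct ends of the drawn edge, so
      exactly one direction is selected.\<close>
    moreover have "v (T {x, y}) \<in> {\<phi> x, \<phi> y}" using T[OF e] by auto
    ultimately show "((x, y) \<in> D) \<noteq> ((y, x) \<in> D)"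
      using e by (auto simp: D_def insert_commute)
  qed (auto simp: D_def)
  then have le: "min_max_out_degree V E \<le> max_out_degree V D" by (rule min_max_out_degree_le[OF G(1)])
  have "finite V" using G by (simp add: simple_graph_def)
  then obtain x where x: "x \<in> V" "card (D `` {x}) = max_out_degree V D"
    using ex_card_out_eq_max_out_degree simple_graph_nonempty[OF G] by blast
  have "card (D `` {x}) \<le> card {t \<in> {..<m}. v t = \<phi> x}"
  proof (rule card_inj_on_le)
    show "inj_on (\<lambda>y. T {x, y}) (D `` {x})"
    proof (rule inj_onI)
      fix y z assume yz: "y \<in> D `` {x}" "z \<in> D `` {x}" "T {x, y} = T {x, z}"
      then have E: "{x, y} \<in> E" "{x, z} \<in> E" by (auto simp: D_def)
      then have "\<phi> ` {x, y} = \<phi> ` {x, z}" using T[OF E(1)] T[OF E(2)] yz(3) by metis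
      moreover have V: "{x, y} \<subseteq> V" "{x, z} \<subseteq> V" using E G by (auto simp: simple_graph_def)
      ultimately have "{x, y} = {x, z}" using inj_on_image_eq_iff[OF \<phi>(1) V] by blast
      then show "y = z" by (metis doubleton_eq_iff)
    qed
    show "(\<lambda>y. T {x, y}) ` (D `` {x}) \<subseteq> {t \<in> {..<m}. v t = \<phi> x}"
      using T by (auto simp: D_def)
  qed simp
  then show ?thesis using x \<phi>(2) le by (intro bexI[of _ "\<phi> x"]) auto
qed

text \<open>Each \<open>x\<close> has \<open>r\<close> rounds of its own, \<open>\<tau> x j\<close>
  with \<open>j < r\<close>, in which its image is offered. At most \<open>r\<close> arcs leave
  \<open>x\<close>, so an injective labelling of its out-neighbours gives every arc a round, in
  which Builder answers with the image of the head.\<close>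

lemma ex_contains_copy:
  assumes G: "simple_graph V E" and D: "orientation E D" "\<And>x. x \<in> V \<Longrightarrow> card (D `` {x}) \<le> r"
    and "n > 0" and \<phi>: "inj_on \<phi> V" "\<phi> ` V \<subseteq> {1..n}"
    and \<tau>: "inj_on (\<lambda>(x, j). \<tau> x j) (V \<times> {..<r})"
      "\<And>x j. x \<in> V \<Longrightarrow> j < r \<Longrightarrow> \<tau> x j < m \<and> v (\<tau> x j) = \<phi> x"
  shows "\<exists>u. (\<forall>t. u t \<in> {1..n}) \<and> contains_copy V E (builder_graph n m v u)"
proof -
  have sub: "D \<subseteq> V \<times> V" using orientation_subset[OF G D(1)] .
  have fin: "finite V" using G by (simp add: simple_graph_def)
  have "\<exists>l. l ` (D `` {x}) \<subseteq> {..<r} \<and> inj_on l (D `` {x})" if "x \<in> V" for x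
  proof (rule card_le_inj)
    show "finite (D `` {x})" using sub by (intro finite_subset[OF _ fin]) auto
  qed (use D(2)[OF that] in auto)
  then obtain l where l: "\<And>x. x \<in> V \<Longrightarrow> l x ` (D `` {x}) \<subseteq> {..<r} \<and> inj_on (l x) (D `` {x})"
    by metis
  define \<theta> where "\<theta> = (\<lambda>(x, y). \<tau> x (l x y))"
  have l_less: "l x y < r" if "(x, y) \<in> D" for x y using l[of x] sub that by auto
  have inj: "inj_on \<theta> D"
  proof (rule inj_onI, clarify)
    fix x y x' y' assume xy: "(x, y) \<in> D" "(x', y') \<in> D" "\<theta> (x, y) = \<theta> (x', y')"
    then have "x = x' \<and> l x y = l x' y'"
      using inj_onD[OF \<tau>(1), of "(x, l x y)" "(x', l x' y')"] l_less sub by (auto simp: \<theta>_def)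
    moreover from this have "y = y'" using l[of x] sub xy by (auto dest: inj_onD)
    ultimately show "x = x' \<and> y = y'" by simp
  qed
  \<comment> \<open>Distinct arcs have distinct rounds, so a used round determines its arc and
    thereby the reply; all other rounds get the legal reply 1.\<close>
  define u where "u t = (if t \<in> \<theta> ` D then \<phi> (snd (the_inv_into D \<theta> t)) else 1)" for t
  have "u t \<in> {1..n}" for t
  proof (cases "t \<in> \<theta> ` D")
    case True
    then have "the_inv_into D \<theta> t \<in> D" by (rule the_inv_into_into[OF inj]) simp
    then have "snd (the_inv_into D \<theta> t) \<in> V" using sub by (auto simp: mem_Times_iff)
    then have "\<phi> (snd (the_inv_into D \<theta> t)) \<in> {1..n}" using \<phi>(2) by blast
    then show ?thesis using True by (simp add: u_def)
  qed (use \<open>n > 0\<close> in \<open>simp add: u_def\<close>)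
  moreover have edge: "\<exists>t<m. {u t, v t} = {\<phi> x, \<phi> y}" if "(x, y) \<in> D" for x y
  proof -
    have "u (\<theta> (x, y)) = \<phi> y" using that by (simp add: u_def the_inv_into_f_f[OF inj])
    moreover have "\<theta> (x, y) < m \<and> v (\<theta> (x, y)) = \<phi> x"
      using \<tau>(2) l_less[OF that] that sub by (auto simp: \<theta>_def)
    ultimately show ?thesis by (intro exI[of _ "\<theta> (x, y)"]) auto
  qed
  have "\<exists>t<m. {u t, v t} = \<phi> ` e" if e: "e \<in> E" for e
  proof -
    obtain x y where xy: "e = {x, y}" using e G by (auto simp: simple_graph_def card_2_iff)
    then have "(x, y) \<in> D \<or> (y, x) \<in> D" using D(1) e unfolding orientation_def by blast
    then show ?thesis using edge[of x y] edge[of y x] xy by (auto simp: insert_commute)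
  qed
  then have "contains_copy V E (builder_graph n m v u)"
    unfolding contains_copy_def using \<phi> by (intro exI[of _ \<phi>]) simp
  ultimately show ?thesis by blast
qed

text \<open>Success forces some vertex to be offered in all rounds of some \<open>r\<close>-set. The
  union bound runs over \<open>n\<close> vertices and \<open>m choose r\<close> sets, each pair
  having probability \<open>(1 / n) ^ r\<close>.\<close>

lemma success_prob_contains_copy_le:
  assumes G: "simple_graph V E" "E \<noteq> {}" and "n > 0" "S \<in> strategies n"
    and r: "r = min_max_out_degree V E"
  shows "success_prob (contains_copy V E) n S m \<le> n * (m / n) ^ r"
proof -
  interpret prob_space "random_seq n" using prob_space_random_seq[OF \<open>n > 0\<close>] .
  define TT where "TT = {T. T \<subseteq> {..<m} \<and> card T = r}"
  have "finite TT" unfolding TT_def by simp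
  have finT: "finite T" "card T = r" if "T \<in> TT" for T
    using that finite_subset[of T "{..<m}"] by (auto simp: TT_def)
  define C where "C a T = {v \<in> space (random_seq n). \<forall>t\<in>T. v t = a}" for a T
  have prob_C: "prob (C a T) = (1 / n) ^ r" if "a \<in> {1..n}" "T \<in> TT" for a T
    unfolding C_def using prob_random_seq_cylinder[of n T "\<lambda>_. a"] that finT[OF that(2)] \<open>n > 0\<close> by simp
  have C_sets: "C a T \<in> events" if "T \<in> TT" for a T
    using finT[OF that] unfolding C_def by measurable
  have m[measurable]: "Measurable.pred (vertex_seqs n) (\<lambda>v. v t = a)" for t a
    by (rule measurable_compose[OF measurable_vertex_seqs]) simp
  have "success_prob (contains_copy V E) n S m \<le>
        prob {v \<in> space (random_seq n). \<exists>a\<in>{1..n}. \<exists>T\<in>TT. \<forall>t\<in>T. v t = a}"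
  proof (rule success_prob_le[OF \<open>n > 0\<close> \<open>S \<in> strategies n\<close>])
    show "Measurable.pred (vertex_seqs n) (\<lambda>v. \<exists>a\<in>{1..n}. \<exists>T\<in>TT. \<forall>t\<in>T. v t = a)"
      using \<open>finite TT\<close> finT by (intro pred_intros_finite m) auto
    fix v u assume "contains_copy V E (builder_graph n m v u)"
    then obtain a where a: "a \<in> {1..n}" "r \<le> card {t \<in> {..<m}. v t = a}"
      using contains_copy_imp_popular_vertex[OF G] r by blast
    then obtain T where "T \<subseteq> {t \<in> {..<m}. v t = a}" "card T = r"
      by (meson obtain_subset_with_card_n)
    then show "\<exists>a\<in>{1..n}. \<exists>T\<in>TT. \<forall>t\<in>T. v t = a"
      using a(1) by (intro bexI[of _ a] bexI[of _ T]) (auto simp: TT_def)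
  qed
  also have "{v \<in> space (random_seq n). \<exists>a\<in>{1..n}. \<exists>T\<in>TT. \<forall>t\<in>T. v t = a} =
             (\<Union>(a, T)\<in>{1..n} \<times> TT. C a T)"
    by (auto simp: C_def)
  also have "prob \<dots> \<le> (\<Sum>(a, T)\<in>{1..n} \<times> TT. prob (C a T))"
    unfolding case_prod_beta' using \<open>finite TT\<close> C_sets by (intro measure_UNION_le) auto
  also have "\<dots> = (\<Sum>p\<in>{1..n} \<times> TT. (1 / n) ^ r)"
    using prob_C by (intro sum.cong refl) (auto simp del: One_nat_def)
  also have "\<dots> = n * (real (m choose r) * (1 / n) ^ r)"
    unfolding TT_def by (simp add: card_cartesian_product n_subsets)
  also have "\<dots> \<le> n * (real m ^ r * (1 / n) ^ r)"
  proof -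
    have "m choose r \<le> m ^ r" by (cases "r \<le> m") (auto simp: binomial_le_pow binomial_eq_0)
    then have "real (m choose r) \<le> real m ^ r" by (metis of_nat_le_iff of_nat_power)
    then show ?thesis by (intro mult_left_mono mult_right_mono) auto
  qed
  finally show ?thesis by (simp add: power_divide)
qed

section \<open>Thresholds\<close>

text \<open>The pattern vertex numbered \<open>i\<close> owns the part \<open>A i\<close> and the
  intervals \<open>P i j\<close> with \<open>j < r\<close>. With probability at most
  \<open>2 ^ r / \<mu>\<close> no vertex of \<open>A i\<close> is offered in all of these intervals;
  the union bound over the pattern vertices gives the factor \<open>card V\<close>.\<close>

lemma ex_strategy_contains_copy:
  fixes V :: "'a set"
  assumes G: "simple_graph V E" and "n > 0" and r: "r = min_max_out_degree V E"
    and "L \<le> n" "card V * r * L \<le> m" and \<mu>: "\<mu> = (n div card V) * (L / n) ^ r" "\<mu> > 0"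
  shows "\<exists>S \<in> strategies n. success_prob (contains_copy V E) n S m \<ge> 1 - card V * (2 ^ r / \<mu>)"
proof -
  interpret prob_space "random_seq n" using prob_space_random_seq[OF \<open>n > 0\<close>] .
  have fin: "finite V" using G by (simp add: simple_graph_def)
  obtain D where D: "orientation E D" "max_out_degree V D = r"
    using ex_optimal_orientation[OF G] r by blast
  obtain h where "bij_betw h V {0..<card V}" using ex_bij_betw_finite_nat[OF fin] by blast
  then have h: "inj_on h V" "\<And>x. x \<in> V \<Longrightarrow> h x < card V"
    by (auto simp: bij_betw_def)
  define k where "k = card V"
  define q where "q = n div k"
  have kq: "k * q \<le> n" by (simp add: q_def)
  define A where "A i = {i * q + 1..i * q + q}" for i
  have A: "A i \<subseteq> {1..n}" if "i < k" for i
  proof -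
    have "i * q + q = Suc i * q" by simp
    also have "\<dots> \<le> k * q" using that by (intro mult_le_mono1) simp
    finally show ?thesis using kq by (auto simp: A_def)
  qed
  \<comment> \<open>Integer division recovers the index of the part, which makes the parts disjoint;
    1 is subtracted because vertices are numbered from 1.\<close>
  have A_div: "(a - 1) div q = i" if "a \<in> A i" for a i
    using that by (intro div_nat_eqI) (auto simp: A_def algebra_simps)
  define P where "P i j = {(i * r + j) * L..<(i * r + j) * L + L}" for i j
  \<comment> \<open>Likewise the intervals of length \<open>L\<close> are numbered consecutively by
    \<open>i * r + j\<close>, and with \<open>j < r\<close> this number determines both
    indices.\<close>
  have P_div: "t div L = i * r + j" if "t \<in> P i j" for t i j
    using that by (intro div_nat_eqI) (auto simp: P_def algebra_simps)
  have P_inj: "i = i' \<and> j = j'" if "t \<in> P i j" "t \<in> P i' j'" "j < r" "j' < r" for t i i' j j'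
  proof -
    have eq: "i * r + j = i' * r + j'" using that P_div by metis
    have "i = (i * r + j) div r" "i' = (i' * r + j') div r" using that by auto
    then have "i = i'" using eq by simp
    then show ?thesis using eq by simp
  qed
  have P_less: "t < m" if "t \<in> P i j" "i < k" "j < r" for t i j
  proof -
    have "i * r + j + 1 \<le> Suc i * r" using that by simp
    also have "\<dots> \<le> k * r" using that by (intro mult_le_mono1) simp
    finally have "(i * r + j + 1) * L \<le> k * r * L" by (intro mult_le_mono1)
    then show ?thesis using that assms(5) by (simp add: P_def k_def algebra_simps)
  qed
  define B where "B i v \<longleftrightarrow> (\<exists>a\<in>A i. \<forall>j\<in>{..<r}. \<exists>t\<in>P i j. v t = a)" for i v
  have m: "Measurable.pred (vertex_seqs n) (\<lambda>v. v t = a)" for t a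
    by (rule measurable_compose[OF measurable_vertex_seqs]) simp
  have B_meas [measurable]: "Measurable.pred (vertex_seqs n) (B i)" for i
    unfolding B_def by (intro pred_intros_finite m) (auto simp: A_def P_def)
  have "1 - card V * (2 ^ r / \<mu>) \<le> prob {v \<in> space (random_seq n). \<forall>i\<in>{..<k}. B i v}"
  proof -
    have "prob {v \<in> space (random_seq n). \<not> B i v} \<le> 2 ^ card {..<r} / \<mu>" if "i < k" for i
      unfolding B_def
    proof (rule prob_no_common_hit_le[where L = L])
      show "disjoint_family_on (P i) {..<r}"
        unfolding disjoint_family_on_def using P_inj by blast
      show "\<mu> = card (A i) * (L / n) ^ card {..<r}" unfolding \<mu> by (simp add: A_def q_def k_def)
    qed (use \<open>n > 0\<close> \<open>L \<le> n\<close> A[OF that] \<mu>(2) in \<open>auto simp: P_def\<close>)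
    then have "(\<Sum>i\<in>{..<k}. prob {v \<in> space (random_seq n). \<not> B i v}) \<le> (\<Sum>i\<in>{..<k}. 2 ^ r / \<mu>)"
      by (intro sum_mono) simp
    moreover have "prob (\<Union>i\<in>{..<k}. {v \<in> space (random_seq n). \<not> B i v}) \<le>
       (\<Sum>i\<in>{..<k}. prob {v \<in> space (random_seq n). \<not> B i v})"
      by (intro measure_UNION_le) auto
    moreover have "prob {v \<in> space (random_seq n). \<forall>i\<in>{..<k}. B i v} =
      1 - prob (\<Union>i\<in>{..<k}. {v \<in> space (random_seq n). \<not> B i v})"
      by (subst prob_compl[symmetric]) (auto intro!: arg_cong[where f = prob])
    ultimately show ?thesis by (simp add: k_def)
  qed
  moreover have "\<exists>S \<in> strategies n. success_prob (contains_copy V E) n S m \<ge>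
    prob {v \<in> space (random_seq n). \<forall>i\<in>{..<k}. B i v}"
  proof (rule ex_strategy_success_prob_ge[OF \<open>n > 0\<close> fin])
    show "E \<subseteq> Pow V" using G by (auto simp: simple_graph_def)
    show "Measurable.pred (vertex_seqs n) (\<lambda>v. \<forall>i\<in>{..<k}. B i v)" by measurable
    fix v assume "\<forall>i\<in>{..<k}. B i v"
    then have "\<forall>i\<in>{..<k}. \<exists>a. a \<in> A i \<and> (\<forall>j\<in>{..<r}. \<exists>t\<in>P i j. v t = a)"
      unfolding B_def by blast
    \<comment> \<open>In the good event \<open>a i\<close> serves as image of the pattern vertex
      numbered \<open>i\<close>, and the rounds \<open>T i j\<close> offer it. Disjointness of the
      parts makes the embedding injective; disjointness of the intervals makes the rounds
      distinct.\<close>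
    then obtain a where a: "\<And>i. i < k \<Longrightarrow> a i \<in> A i"
      and "\<And>i j. i < k \<Longrightarrow> j < r \<Longrightarrow> \<exists>t\<in>P i j. v t = a i"
      by (metis lessThan_iff)
    then obtain T where T: "\<And>i j. i < k \<Longrightarrow> j < r \<Longrightarrow> T i j \<in> P i j \<and> v (T i j) = a i"
      by metis
    show "\<exists>u. (\<forall>t. u t \<in> {1..n}) \<and> contains_copy V E (builder_graph n m v u)"
    proof (rule ex_contains_copy[OF G D(1) _ \<open>n > 0\<close>, where \<phi> = "\<lambda>x. a (h x)" and \<tau> = "\<lambda>x. T (h x)"])
      show "card (D `` {x}) \<le> r" if "x \<in> V" for x
        using card_out_le_max_out_degree[OF fin that, of D] D(2) by simp
      show "inj_on (\<lambda>x. a (h x)) V"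
      proof (rule inj_onI)
        fix x y assume xy: "x \<in> V" "y \<in> V" "a (h x) = a (h y)"
        then have "h x = h y" using A_div[OF a] h(2) by (metis k_def)
        then show "x = y" using h(1) xy by (auto dest: inj_onD)
      qed
      show "(\<lambda>x. a (h x)) ` V \<subseteq> {1..n}"
      proof (rule image_subsetI)
        fix x assume "x \<in> V"
        then have "h x < k" using h(2) by (simp add: k_def)
        then show "a (h x) \<in> {1..n}" using a A by blast
      qed
      show "inj_on (\<lambda>(x, j). T (h x) j) (V \<times> {..<r})"
      proof (rule inj_onI, clarify)
        fix x j x' j' assume *: "x \<in> V" "j < r" "x' \<in> V" "j' < r" "T (h x) j = T (h x') j'"
        have "T (h x) j \<in> P (h x) j" "T (h x') j' \<in> P (h x') j'"
          using T h(2) *(1-4) unfolding k_def by blast+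
        then have "h x = h x' \<and> j = j'" using P_inj * by metis
        then show "x = x' \<and> j = j'" using h(1) * by (auto dest: inj_onD)
      qed
      show "T (h x) j < m \<and> v (T (h x) j) = a (h x)" if "x \<in> V" "j < r" for x j
        using T[of "h x" j] P_less[of "T (h x) j" "h x" j] h(2)[OF that(1)] that by (simp add: k_def)
    qed
  qed
  ultimately show ?thesis by (meson order_trans)
qed

section \<open>From success probabilities to thresholds\<close>

lemma le_tau:
  assumes "\<And>S m. S \<in> strategies n \<Longrightarrow> success_prob P n S m \<ge> p \<Longrightarrow> x \<le> real m"
  shows "ereal x \<le> ereal_of_enat (tau P n p)"
proof -
  \<comment> \<open>\<open>tau\<close> takes extended natural values, so the real bound is rounded
    up first; \<open>nat\<close> truncates a negative bound to 0, which is below every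
    \<open>m\<close> anyway.\<close>
  have "enat (nat \<lceil>x\<rceil>) \<le> tau P n p"
    unfolding tau_def tau_strategy_def
  proof (intro INF_greatest)
    fix S m assume "S \<in> strategies n" "m \<in> {m. p \<le> success_prob P n S m}"
    then have "x \<le> real m" using assms by blast
    then show "enat (nat \<lceil>x\<rceil>) \<le> enat m" by (simp add: ceiling_le_iff nat_le_iff)
  qed
  then have "ereal_of_enat (enat (nat \<lceil>x\<rceil>)) \<le> ereal_of_enat (tau P n p)"
    by (simp only: ereal_of_enat_le_iff)
  moreover have "ereal x \<le> ereal_of_enat (enat (nat \<lceil>x\<rceil>))"
    by (simp add: real_nat_ceiling_ge)
  ultimately show ?thesis by (rule order_trans[rotated])
qed

lemma tau_le:
  assumes "S \<in> strategies n" "success_prob P n S m \<ge> p" "real m \<le> x"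
  shows "ereal_of_enat (tau P n p) \<le> ereal x"
proof -
  have "tau P n p \<le> enat m"
    unfolding tau_def tau_strategy_def using assms by (auto intro!: INF_lower2)
  then have "ereal_of_enat (tau P n p) \<le> ereal_of_enat (enat m)"
    by (simp only: ereal_of_enat_le_iff)
  also have "\<dots> \<le> ereal x" using assms(3) by simp
  finally show ?thesis .
qed

text \<open>The \<open>r\<close>-th power clears the fractional exponent, so that the later
  estimates involve only natural powers of \<open>n\<close>.\<close>

lemma powr_exponent_power:
  assumes "n > 0" "r > 0"
  shows "(real n powr ((real r - 1) / real r)) ^ r = real n ^ (r - 1)"
proof -
  have "(real n powr ((real r - 1) / real r)) ^ r = real n powr (real r - 1)"
    using assms by (simp add: powr_power)
  also have "\<dots> = real n powr real (r - 1)" using assms by (simp add: of_nat_diff)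
  also have "\<dots> = real n ^ (r - 1)" using assms by (intro powr_realpow) simp
  finally show ?thesis .
qed

text \<open>If \<open>0 < f n < 1\<close>, having fewer rounds than claimed keeps the union bound
  strictly below \<open>f n ^ r\<close>, so no strategy reaches success probability
  \<open>\<epsilon> n\<close>. If \<open>f n \<le> 0\<close>, the claimed bound is trivial.\<close>

lemma whp_tau_ge_contains_copy:
  assumes G: "simple_graph V E" "E \<noteq> {}" and r: "r = min_max_out_degree V E"
    and f: "f \<longlonglongrightarrow> 0"
  shows "whp_tau_ge (contains_copy V E) (\<lambda>n. f n * real n powr ((real r - 1) / real r))"
proof -
  have "r > 0" using min_max_out_degree_pos[OF G] r by simp
  \<comment> \<open>The absolute value allows for negative \<open>f n\<close>, and the minimum keeps
    \<open>\<epsilon> n\<close> a probability.\<close>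
  define \<epsilon> where "\<epsilon> n = min 1 (\<bar>f n\<bar> ^ r)" for n
  have "\<epsilon> \<longlonglongrightarrow> min 1 (\<bar>0\<bar> ^ r)" unfolding \<epsilon>_def by (intro tendsto_intros f)
  then have lim: "\<epsilon> \<longlonglongrightarrow> 0" using \<open>r > 0\<close> by (simp add: zero_power)
  have "\<forall>\<^sub>F n in sequentially. f n < 1" using f by (rule order_tendstoD) simp
  with eventually_gt_at_top[of 0]
  have "\<forall>\<^sub>F n in sequentially. ereal (f n * real n powr ((real r - 1) / real r)) \<le>
     ereal_of_enat (tau (contains_copy V E) n (\<epsilon> n))"
  proof eventually_elim
    case (elim n)
    show ?case
    proof (rule le_tau)
      fix S m assume S: "S \<in> strategies n" "\<epsilon> n \<le> success_prob (contains_copy V E) n S m"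
      show "f n * real n powr ((real r - 1) / real r) \<le> real m"
      proof (rule ccontr)
        assume less: "\<not> f n * real n powr ((real r - 1) / real r) \<le> real m"
        \<comment> \<open>As \<open>m\<close> is nonnegative, the claim can fail only for positive
          \<open>f n\<close>; together with \<open>f n < 1\<close> this removes the absolute value
          and the minimum from \<open>\<epsilon> n\<close>.\<close>
        then have pos: "f n > 0"
          by (metis linorder_not_le mult_nonpos_nonneg of_nat_0_le_iff order_trans powr_ge_zero)
        then have "f n ^ r \<le> 1" using elim by (intro power_le_one) auto
        then have "\<epsilon> n = f n ^ r" using pos by (simp add: \<epsilon>_def)
        then have "f n ^ r \<le> n * (m / n) ^ r"
          using S(2) success_prob_contains_copy_le[OF G elim(1) S(1) r, of m] by linarith
        moreover have "real m ^ r < (f n * real n powr ((real r - 1) / real r)) ^ r"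
          using less \<open>r > 0\<close> by (intro power_strict_mono) auto
        then have "real m ^ r < f n ^ r * real n ^ (r - 1)"
          using powr_exponent_power[OF elim(1) \<open>r > 0\<close>] by (simp add: power_mult_distrib)
        then have "n * (m / n) ^ r < n * (f n ^ r * real n ^ (r - 1) / n ^ r)"
          using elim by (simp add: power_divide divide_strict_right_mono)
        moreover have "n * (f n ^ r * real n ^ (r - 1) / n ^ r) = f n ^ r"
          using elim \<open>r > 0\<close> by (cases r) auto
        ultimately show False by simp
      qed
    qed
  qed
  then show ?thesis unfolding whp_tau_ge_def using lim
    by (intro exI[of _ \<epsilon>]) (auto simp: \<epsilon>_def)
qed

text \<open>Run the interval construction with intervals of length about \<open>w n * X n\<close>,
  where \<open>w\<close> tends to infinity. Then \<open>\<mu> n\<close> tends to infinity too, and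
  the failure bound \<open>k * (2 ^ r / \<mu> n)\<close> tends to 0.\<close>

lemma whp_tau_le_contains_copy:
  assumes G: "simple_graph V E" "E \<noteq> {}" and r: "r = min_max_out_degree V E"
    and g: "filterlim g at_top sequentially"
  shows "whp_tau_le (contains_copy V E) (\<lambda>n. g n * real n powr ((real r - 1) / real r))"
proof -
  have "r > 0" using min_max_out_degree_pos[OF G] r by simp
  define k where "k = card V"
  have "k > 0" using G simple_graph_nonempty[OF G] by (simp add: k_def simple_graph_def card_gt_0_iff)
  define X where "X n = real n powr ((real r - 1) / real r)" for n :: nat
  \<comment> \<open>The divisor pays for the \<open>k * r\<close> intervals, so that together they
    fit into \<open>g n * X n\<close> rounds. The cap \<open>n powr (1 / r)\<close> guarantees
    \<open>L n \<le> n\<close>, since \<open>n powr (1 / r) * X n = n\<close>.\<close>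
  define w where "w n = min (g n) (real n powr (1 / real r)) / (k * r)" for n
  define L where "L n = nat \<lfloor>w n * X n\<rfloor>" for n
  define \<mu> where "\<mu> n = (n div k) * (L n / n) ^ r" for n :: nat
  define \<epsilon> where "\<epsilon> n = min 1 (k * (2 ^ r / \<mu> n))" for n
  have \<mu>_nonneg: "\<mu> n \<ge> 0" for n by (simp add: \<mu>_def)
  have kr: "real k * real r > 0" "real k * real r \<ge> 1"
    using \<open>k > 0\<close> \<open>r > 0\<close> by (auto simp flip: of_nat_mult)
  have "filterlim (\<lambda>n::nat. real n powr (1 / real r)) at_top sequentially"
  proof -
    have "1 / real r > 0" using \<open>r > 0\<close> by simp
    then show ?thesis by real_asymp
  qed
  with g have "filterlim (\<lambda>n. min (g n) (real n powr (1 / real r))) at_top sequentially"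
    by (simp add: filterlim_at_top eventually_conj_iff)
  then have w: "filterlim w at_top sequentially"
    using filterlim_tendsto_pos_mult_at_top[OF tendsto_const[of "1 / (k * r)"]] kr(1)
    by (simp add: w_def[abs_def])
  have X_pow: "X n ^ r = real n ^ (r - 1)" if "n > 0" for n
    unfolding X_def using powr_exponent_power[OF that \<open>r > 0\<close>] .
  have X_ge: "X n \<ge> 1" if "n > 0" for n
    unfolding X_def using that \<open>r > 0\<close> by (intro ge_one_powr_ge_zero) auto
  have large: "\<forall>\<^sub>F n in sequentially. n \<ge> k \<and> w n \<ge> 2"
    using w eventually_ge_at_top[of k] by (simp add: filterlim_at_top eventually_conj_iff)
  \<comment> \<open>Rounding down costs at most \<open>1 \<le> X n\<close>, which turns
    \<open>w n\<close> into \<open>w n - 1\<close>; \<open>n \<ge> k\<close> gives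
    \<open>n div k \<ge> n / (2 * k)\<close>; and \<open>w n - 1 \<ge> 1\<close> lets the
    \<open>r\<close>-th power be replaced by the first.\<close>
  have \<mu>_ge: "\<forall>\<^sub>F n in sequentially. (w n - 1) \<le> 2 * k * \<mu> n"
    using large
  proof eventually_elim
    case (elim n)
    then have "n > 0" using \<open>k > 0\<close> by simp
    have "w n * X n - 1 \<le> real (L n)" unfolding L_def by linarith
    then have "(w n - 1) * X n \<le> L n" using X_ge[OF \<open>n > 0\<close>] by (simp add: algebra_simps)
    then have "((w n - 1) * X n) ^ r \<le> L n ^ r"
      using elim X_ge[OF \<open>n > 0\<close>] unfolding of_nat_power by (intro power_mono) auto
    then have "(w n - 1) ^ r * real n ^ (r - 1) / n ^ r \<le> (L n / n) ^ r"
      using X_pow[OF \<open>n > 0\<close>] by (simp add: power_mult_distrib power_divide divide_right_mono)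
    moreover have "(w n - 1) ^ r * real n ^ (r - 1) / n ^ r = (w n - 1) ^ r / n"
      using \<open>n > 0\<close> \<open>r > 0\<close> by (cases r) auto
    ultimately have 1: "(w n - 1) ^ r / n \<le> (L n / n) ^ r" by simp
    have "n \<le> 2 * k * (n div k)"
    proof -
      have "n = k * (n div k) + n mod k" by simp
      also have "\<dots> \<le> k * (n div k) + k * 1" using \<open>k > 0\<close> by (intro add_left_mono) (simp add: less_imp_le)
      also have "\<dots> \<le> k * (n div k) + k * (n div k)"
      proof (intro add_left_mono mult_le_mono2)
        show "1 \<le> n div k" using div_le_mono[of k n k] elim \<open>k > 0\<close> by simp
      qed
      finally show ?thesis by simp
    qed
    then have "real n \<le> real (2 * k * (n div k))" by (simp only: of_nat_le_iff)
    then have 2: "real n \<le> 2 * k * real (n div k)" by (simp only: of_nat_mult of_nat_numeral)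
    have "w n - 1 \<le> (w n - 1) ^ r"
      using elim \<open>r > 0\<close> by (intro self_le_power) auto
    also have "\<dots> = n * ((w n - 1) ^ r / n)" using \<open>n > 0\<close> by simp
    also have "\<dots> \<le> (2 * k * real (n div k)) * (L n / n) ^ r"
      using elim by (intro mult_mono 1 2) auto
    finally show ?case by (simp add: \<mu>_def mult_ac)
  qed
  have "filterlim (\<lambda>n. 2 * k * \<mu> n) at_top sequentially"
  proof (rule filterlim_at_top_mono[OF _ \<mu>_ge])
    show "filterlim (\<lambda>n. w n - 1) at_top sequentially"
      using filterlim_tendsto_add_at_top[OF tendsto_const w, of "-1"] by simp
  qed
  \<comment> \<open>The numerator is chosen so that cancelling \<open>2 * k\<close> leaves
    \<open>k * (2 ^ r / \<mu> n)\<close>.\<close>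
  then have "(\<lambda>n. (2 * k * k * 2 ^ r) / (2 * k * \<mu> n)) \<longlonglongrightarrow> 0"
    by (intro tendsto_divide_0[OF tendsto_const] filterlim_at_top_imp_at_infinity)
  then have "(\<lambda>n. k * (2 ^ r / \<mu> n)) \<longlonglongrightarrow> 0" using \<open>k > 0\<close> by simp
  then have "\<epsilon> \<longlonglongrightarrow> min 1 0" unfolding \<epsilon>_def by (intro tendsto_intros)
  then have lim: "\<epsilon> \<longlonglongrightarrow> 0" by simp
  have "\<forall>\<^sub>F n in sequentially. ereal_of_enat (tau (contains_copy V E) n (1 - \<epsilon> n)) \<le> ereal (g n * X n)"
    using large \<mu>_ge
  proof eventually_elim
    case (elim n)
    then have "n > 0" using \<open>k > 0\<close> by simp
    have "2 * k * \<mu> n > 0" using elim by linarith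
    then have "\<mu> n > 0" using \<open>k > 0\<close> by (simp add: zero_less_mult_iff)
    have "w n * X n \<ge> 0" using elim X_ge[OF \<open>n > 0\<close>] by simp
    then have L_le: "L n \<le> w n * X n" unfolding L_def by linarith
    have "L n \<le> n"
    proof -
      have "w n \<le> real n powr (1 / real r)"
      proof -
        have "w n * 1 \<le> w n * (k * r)" using elim kr(2) by (intro mult_left_mono) auto
        also have "\<dots> \<le> real n powr (1 / real r)" using kr(1) by (simp add: w_def)
        finally show ?thesis by simp
      qed
      then have "w n * X n \<le> real n powr (1 / real r) * X n"
        using X_ge[OF \<open>n > 0\<close>] by (intro mult_right_mono) auto
      also have "\<dots> = real n powr (1 / real r + (real r - 1) / real r)" by (simp add: X_def powr_add)
      also have "1 / real r + (real r - 1) / real r = 1" using \<open>r > 0\<close> by (simp add: field_simps)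
      finally show ?thesis using L_le by simp
    qed
    then obtain S where S: "S \<in> strategies n"
      "success_prob (contains_copy V E) n S (k * r * L n) \<ge> 1 - k * (2 ^ r / \<mu> n)"
      using ex_strategy_contains_copy[OF G(1) \<open>n > 0\<close> r, of "L n" "k * r * L n" "\<mu> n"] \<open>\<mu> n > 0\<close>
      unfolding k_def \<mu>_def by auto
    show ?case
    proof (rule tau_le[OF S(1)])
      \<comment> \<open>Where the cap makes \<open>\<epsilon> n = 1\<close>, the claim is just
        nonnegativity of the success probability.\<close>
      show "1 - \<epsilon> n \<le> success_prob (contains_copy V E) n S (k * r * L n)"
        using S(2) by (auto simp: \<epsilon>_def min_def success_prob_def)
      have "real (k * r * L n) \<le> k * r * (w n * X n)"
        unfolding of_nat_mult using L_le by (intro mult_left_mono) auto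
      also have "\<dots> = (k * r * w n) * X n" by simp
      also have "\<dots> \<le> g n * X n"
        using kr(1) X_ge[OF \<open>n > 0\<close>] by (intro mult_right_mono) (auto simp: w_def)
      finally show "real (k * r * L n) \<le> g n * X n" .
    qed
  qed
  then show ?thesis unfolding whp_tau_le_def X_def using lim \<mu>_nonneg
    by (intro exI[of _ \<epsilon>]) (auto simp: \<epsilon>_def)
qed

theorem theorem1p8:
  fixes V :: "'a set" and E :: "'a set set" and r :: nat and f g :: "nat \<Rightarrow> real"
  assumes "simple_graph V E" and "E \<noteq> {}"
    and "r = min_max_out_degree V E"
    and "f \<longlonglongrightarrow> 0"
    and "filterlim g at_top sequentially"
  shows "whp_tau_ge (contains_copy V E) (\<lambda>n. f n * real n powr ((real r - 1) / real r)) \<and>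
         whp_tau_le (contains_copy V E) (\<lambda>n. g n * real n powr ((real r - 1) / real r))"
  using whp_tau_ge_contains_copy[OF assms(1-4)] whp_tau_le_contains_copy[OF assms(1-3,5)] by blast

end
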